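(* Let $f:\mathbb{R}^D\to\mathbb{R}^D$ be smooth and consider the dynamical system $\frac{d}{dt}y(t)=f(y(t))$, $y(0)=x$, with flow map $\phi_{t,f}$. Let $\alpha_0,\dots,\alpha_M,\beta_0,\dots,\beta_M\in\mathbb{R}$ be the coefficients of a weakly stable and consistent linear multistep method with $\sum_{m=0}^M\beta_m=1$. Then there exist unique $h$-independent functions $f_k:\mathbb{R}^D\to\mathbb{R}^D$, $k=0,1,2,\dots$, such that for any truncation index $K\ge 0$ the function $f_h^K=\sum_{k=0}^K h^k f_k$ satisfies, for every $x$, $$\sum_{m=0}^M\alpha_m\phi_{mh,f}(x)=h\sum_{m=0}^M\beta_m f_h^K(\phi_{mh,f}(x))+\mathcal{O}(h^{K+2}).$$ In particular, for $k\ge 0$, the functions $f_k$ are given by $$f_k(y)=\sum_{m=0}^M\alpha_m\frac{m^{k+1}}{(k+1)!}(\mathbf{D}^kf)(y)-\sum_{m=0}^M\beta_m\sum_{j=1}^k\frac{m^j}{j!}(\mathbf{D}^jf_{k-j})(y).$$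
   Context: The flow map $\phi_{t,f}(x)=y(t)$ is the time-$t$ solution of $\frac{d}{dt}y=f(y)$, $y(0)=x$. A linear multistep method (LMM) is given by the formula $\sum_{m=0}^M\alpha_m y_m-h\sum_{m=0}^M\beta_m f(y_m)=0$ with $\alpha_M\ne 0$ and $|\alpha_0|+|\beta_0|>0$. It is weakly stable if $\sum_{m=0}^M m\,\alpha_m\neq 0$; it is consistent if $\sum_{m=0}^M\alpha_m=0$ and $\sum_{m=0}^M m\,\alpha_m=\sum_{m=0}^M\beta_m$. The Lie derivative associated with $f$ is $\mathbf{D}g(y)=g'(y)f(y)$ for smooth $g:\mathbb{R}^D\to\mathbb{R}^D$; $\mathbf{D}^k$ is its $k$-fold iterate and $\mathbf{D}^0g=g$. The relation with $\mathcal{O}(h^{K+2})$ is understood as $h\to0$ for fixed $x$, i.e. the Taylor (formal power) series in $h$ of the two sides agree through order $h^{K+1}$. Empty sums are zero. *)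

theory Defs
  imports "HOL-Analysis.Analysis" "HOL-Library.Landau_Symbols"
begin

(* C^n on the whole space: a finite-dimensional domain is assumed because the derivative is
   tested direction by direction. *)
primrec Ck_map :: "nat \<Rightarrow> ('a::euclidean_space \<Rightarrow> 'b::real_normed_vector) \<Rightarrow> bool" where
  "Ck_map 0 g \<longleftrightarrow> continuous_on UNIV g"
| "Ck_map (Suc n) g \<longleftrightarrow>
     (\<forall>x. g differentiable (at x)) \<and> (\<forall>v. Ck_map n (\<lambda>x. frechet_derivative g (at x) v))"

definition smooth_map :: "('a::euclidean_space \<Rightarrow> 'b::real_normed_vector) \<Rightarrow> bool" where
  "smooth_map g \<longleftrightarrow> (\<forall>n. Ck_map n g)"

definition ivp_solution ::
  "('a::real_normed_vector \<Rightarrow> 'a) \<Rightarrow> 'a \<Rightarrow> real set \<Rightarrow> (real \<Rightarrow> 'a) \<Rightarrow> bool" where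
  "ivp_solution f x T y \<longleftrightarrow>
     y 0 = x \<and> (\<forall>t\<in>T. (y has_vector_derivative f (y t)) (at t within T))"

(* Completeness of f is not required: the value is meaningful whenever the solution starting
   at x exists up to time t, which for smooth f holds for all t close to 0 (of either sign). *)
definition flow :: "('a::real_normed_vector \<Rightarrow> 'a) \<Rightarrow> real \<Rightarrow> 'a \<Rightarrow> 'a" where
  "flow f t x = (THE z. \<exists>y. ivp_solution f x (closed_segment 0 t) y \<and> y t = z)"

definition lie_derivative ::
  "('a::real_normed_vector \<Rightarrow> 'a) \<Rightarrow> ('a \<Rightarrow> 'a) \<Rightarrow> 'a \<Rightarrow> 'a" where
  "lie_derivative f g = (\<lambda>y. frechet_derivative g (at y) (f y))"

(* A method is given by its coefficients; only the indices 0, ..., M matter. *)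
definition linear_multistep_method :: "nat \<Rightarrow> (nat \<Rightarrow> real) \<Rightarrow> (nat \<Rightarrow> real) \<Rightarrow> bool" where
  "linear_multistep_method M \<alpha> \<beta> \<longleftrightarrow> \<alpha> M \<noteq> 0 \<and> \<bar>\<alpha> 0\<bar> + \<bar>\<beta> 0\<bar> > 0"

definition weakly_stable :: "nat \<Rightarrow> (nat \<Rightarrow> real) \<Rightarrow> bool" where
  "weakly_stable M \<alpha> \<longleftrightarrow> (\<Sum>m\<le>M. real m * \<alpha> m) \<noteq> 0"

definition consistent :: "nat \<Rightarrow> (nat \<Rightarrow> real) \<Rightarrow> (nat \<Rightarrow> real) \<Rightarrow> bool" where
  "consistent M \<alpha> \<beta> \<longleftrightarrow>
     (\<Sum>m\<le>M. \<alpha> m) = 0 \<and> (\<Sum>m\<le>M. real m * \<alpha> m) = (\<Sum>m\<le>M. \<beta> m)"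

definition truncated_field ::
  "(nat \<Rightarrow> 'a::real_normed_vector \<Rightarrow> 'a) \<Rightarrow> nat \<Rightarrow> real \<Rightarrow> 'a \<Rightarrow> 'a" where
  "truncated_field F K h y = (\<Sum>k\<le>K. h ^ k *\<^sub>R F k y)"

(* The implied constant and the range of h may depend on x and K. The norm is there because
   bigo is only available for functions with values in a normed field. *)
definition lmm_matches_flow ::
  "nat \<Rightarrow> (nat \<Rightarrow> real) \<Rightarrow> (nat \<Rightarrow> real) \<Rightarrow> ('a::real_normed_vector \<Rightarrow> 'a) \<Rightarrow>
     (nat \<Rightarrow> 'a \<Rightarrow> 'a) \<Rightarrow> bool" where
  "lmm_matches_flow M \<alpha> \<beta> f F \<longleftrightarrow>
     (\<forall>K x. (\<lambda>h. norm ((\<Sum>m\<le>M. \<alpha> m *\<^sub>R flow f (real m * h) x)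
                  - h *\<^sub>R (\<Sum>m\<le>M. \<beta> m *\<^sub>R truncated_field F K h (flow f (real m * h) x))))
              \<in> O[at 0](\<lambda>h. h ^ (K + 2)))"

end

theory Submission
  imports Defs
begin

text \<open>Along a solution $y$ of $y' = f(y)$ one has $(g \circ y)' = (\mathbf{D} g) \circ y$, so
  $g(\phi_{mh,f}(x))$ has the Taylor coefficients $m^j (\mathbf{D}^j g)(x) / j!$ in $h$. Inserting
  these expansions for $g = \mathrm{id}$ and $g = f_k$ and comparing the coefficients of $h^{n+1}$
  gives an equation whose only term in $f_n$ is $(\sum_m \beta_m) f_n(x) = f_n(x)$: this is the
  recursion for $f_n$. For uniqueness, two families that agree below index $k$ leave
  $\sum_m \beta_m (g_k - f_k)(\phi_{mh,f}(x)) = O(h)$, and $h \to 0$ needs only continuity.\<close>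

subsection \<open>Smooth maps\<close>

lemma Ck_map_imp_continuous_on: "Ck_map n g \<Longrightarrow> continuous_on UNIV g"
  by (cases n) (auto intro!: differentiable_imp_continuous_on simp: differentiable_on_def
      intro: differentiable_at_withinI)

lemma Ck_map_SucD: "Ck_map (Suc n) g \<Longrightarrow> Ck_map n g"
proof (induction n arbitrary: g)
  case 0
  then show ?case using Ck_map_imp_continuous_on[of "Suc 0" g] by simp
next
  case (Suc n)
  then show ?case by (metis Ck_map.simps(2))
qed

text \<open>Uniqueness of the derivative identifies any explicitly given \<open>g'\<close> with
  \<open>frechet_derivative g\<close>, so the usual differentiation rules can feed the induction on
  the order directly.\<close>

lemma Ck_map_SucI:
  assumes "\<And>x. (g has_derivative g' x) (at x)" "\<And>v. Ck_map n (\<lambda>x. g' x v)"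
  shows "Ck_map (Suc n) g"
proof -
  have "frechet_derivative g (at x) = g' x" for x
    using frechet_derivative_at[OF assms(1)] by simp
  then show ?thesis using assms by (auto simp: differentiable_def)
qed

lemma Ck_map_Suc_has_derivative:
  "Ck_map (Suc n) g \<Longrightarrow> (g has_derivative frechet_derivative g (at x)) (at x)"
  by (simp add: frechet_derivative_works)

section \<open>Closure properties of C^n and smooth maps\<close>

lemma Ck_map_const: "Ck_map n (\<lambda>x. c)"
proof (induction n arbitrary: c)
  case (Suc n)
  show ?case by (rule Ck_map_SucI[where g' = "\<lambda>x v. 0"]) (use Suc in auto)
qed simp

lemma Ck_map_id: "Ck_map n (\<lambda>x. x)"
proof (cases n)
  case (Suc k)
  show ?thesis unfolding Suc
    by (rule Ck_map_SucI[where g' = "\<lambda>x v. v"]) (auto intro: Ck_map_const)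
qed simp

lemma Ck_map_add:
  "Ck_map n g \<Longrightarrow> Ck_map n h \<Longrightarrow> Ck_map n (\<lambda>x. g x + h x)"
proof (induction n arbitrary: g h)
  case (Suc n)
  show ?case
    by (rule Ck_map_SucI, rule has_derivative_add[OF Suc.prems[THEN Ck_map_Suc_has_derivative]])
      (use Suc in auto)
qed (auto intro: continuous_on_add)

lemma Ck_map_bounded_linear:
  assumes "bounded_linear L"
  shows "Ck_map n g \<Longrightarrow> Ck_map n (\<lambda>x. L (g x))"
proof (induction n arbitrary: g)
  case 0
  then show ?case using bounded_linear.continuous_on[OF assms] by simp
next
  case (Suc n)
  show ?case
    by (rule Ck_map_SucI, rule bounded_linear.has_derivative[OF assms],
        rule Ck_map_Suc_has_derivative[OF Suc.prems])
      (use Suc in auto)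
qed

text \<open>By the product rule a directional derivative is again a sum of products. These also
  contain the undifferentiated factors, which \<open>Ck_map_SucD\<close> lowers to the order of the
  induction hypothesis.\<close>

lemma Ck_map_scaleR:
  fixes u :: "'a::euclidean_space \<Rightarrow> real"
  shows "Ck_map n u \<Longrightarrow> Ck_map n g \<Longrightarrow> Ck_map n (\<lambda>x. u x *\<^sub>R g x)"
proof (induction n arbitrary: u g)
  case 0
  then show ?case by (auto intro: continuous_on_scaleR)
next
  case (Suc n)
  show ?case
  proof (rule Ck_map_SucI, rule has_derivative_scaleR)
    show "(u has_derivative frechet_derivative u (at x)) (at x)"
      "(g has_derivative frechet_derivative g (at x)) (at x)" for x
      using Suc.prems Ck_map_Suc_has_derivative by blast+
    show "Ck_map n (\<lambda>x. u x *\<^sub>R frechet_derivative g (at x) v + frechet_derivative u (at x) v *\<^sub>R g x)" for v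
      using Suc.prems Suc.prems[THEN Ck_map_SucD] by (intro Ck_map_add Suc.IH) auto
  qed
qed

lemma Ck_map_sum: "(\<And>i. i \<in> A \<Longrightarrow> Ck_map n (g i)) \<Longrightarrow> Ck_map n (\<lambda>x. \<Sum>i\<in>A. g i x)"
  by (induction A rule: infinite_finite_induct) (auto intro: Ck_map_const Ck_map_add)

lemma smooth_map_id: "smooth_map (\<lambda>x. x)"
  by (simp add: smooth_map_def Ck_map_id)

lemma smooth_map_diff: "smooth_map g \<Longrightarrow> smooth_map h \<Longrightarrow> smooth_map (\<lambda>x. g x - h x)"
  unfolding smooth_map_def
  using Ck_map_add[of _ g "\<lambda>x. - h x"]
    Ck_map_bounded_linear[OF bounded_linear_minus[OF bounded_linear_ident], of _ h]
  by simp

lemma smooth_map_scaleR_const: "smooth_map g \<Longrightarrow> smooth_map (\<lambda>x. c *\<^sub>R g x)"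
  by (simp add: smooth_map_def Ck_map_bounded_linear[OF bounded_linear_scaleR_right])

lemma smooth_map_sum: "(\<And>i. i \<in> A \<Longrightarrow> smooth_map (g i)) \<Longrightarrow> smooth_map (\<lambda>x. \<Sum>i\<in>A. g i x)"
  by (simp add: smooth_map_def Ck_map_sum)

lemma smooth_map_imp_continuous_on: "smooth_map g \<Longrightarrow> continuous_on UNIV g"
  using Ck_map_imp_continuous_on smooth_map_def by blast

lemma smooth_map_has_derivative:
  "smooth_map g \<Longrightarrow> (g has_derivative frechet_derivative g (at x)) (at x)"
  using Ck_map_Suc_has_derivative smooth_map_def by blast

text \<open>In \<open>lie_derivative\<close> the direction \<open>f y\<close> moves with the point,
  while \<open>Ck_map\<close> speaks of fixed directions only. Expanding \<open>f y\<close> in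
  \<open>Basis\<close> turns the Lie derivative into a finite sum of coordinates of \<open>f\<close>
  times derivatives of \<open>g\<close> in fixed directions.\<close>

lemma smooth_map_lie_derivative:
  fixes f g :: "'a::euclidean_space \<Rightarrow> 'a"
  assumes "smooth_map f" "smooth_map g"
  shows "smooth_map (lie_derivative f g)"
proof -
  have "lie_derivative f g = (\<lambda>y. \<Sum>i\<in>Basis. (f y \<bullet> i) *\<^sub>R frechet_derivative g (at y) i)"
  proof
    fix y
    interpret D: linear "frechet_derivative g (at y)"
      using smooth_map_has_derivative[OF assms(2)] has_derivative_linear by blast
    have "lie_derivative f g y = frechet_derivative g (at y) (\<Sum>i\<in>Basis. (f y \<bullet> i) *\<^sub>R i)"
      by (simp add: lie_derivative_def euclidean_representation)
    then show "lie_derivative f g y = (\<Sum>i\<in>Basis. (f y \<bullet> i) *\<^sub>R frechet_derivative g (at y) i)"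
      by (simp add: D.sum D.scale)
  qed
  moreover have "Ck_map n (\<lambda>y. frechet_derivative g (at y) i)" for n i
    using assms(2) by (metis Ck_map.simps(2) smooth_map_def)
  ultimately show ?thesis
    using assms(1) unfolding smooth_map_def
    by (auto intro!: Ck_map_sum Ck_map_scaleR Ck_map_bounded_linear[OF bounded_linear_inner_left])
qed

lemma smooth_map_lie_derivative_funpow:
  fixes f g :: "'a::euclidean_space \<Rightarrow> 'a"
  assumes "smooth_map f" "smooth_map g"
  shows "smooth_map ((lie_derivative f ^^ k) g)"
  by (induction k) (auto intro: assms smooth_map_lie_derivative)

lemma lie_derivative_id: "lie_derivative f (\<lambda>x. x) = f"
  by (simp add: lie_derivative_def)

subsection \<open>Local solutions and the flow\<close>

text \<open>Mean value inequality for curves. It bounds the Picard integrals and raises the order of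
  the Taylor remainder by one.\<close>

lemma has_vector_derivative_norm_bound:
  fixes u :: "real \<Rightarrow> 'a::real_normed_vector"
  assumes "convex S" "\<And>t. t \<in> S \<Longrightarrow> (u has_vector_derivative u' t) (at t within S)"
    and "\<And>t. t \<in> S \<Longrightarrow> norm (u' t) \<le> B" "a \<in> S" "b \<in> S"
  shows "norm (u b - u a) \<le> B * \<bar>b - a\<bar>"
proof -
  have "norm (u b - u a) \<le> B * norm (b - a)"
  proof (rule differentiable_bound[OF assms(1) _ _ assms(5,4)])
    fix t assume t: "t \<in> S"
    show "(u has_derivative (\<lambda>h. h *\<^sub>R u' t)) (at t within S)"
      using assms(2)[OF t] by (simp add: has_vector_derivative_def)
    show "onorm (\<lambda>h. h *\<^sub>R u' t) \<le> B"
      by (rule onorm_le) (use assms(3)[OF t] in \<open>simp add: mult.commute[of B] mult_left_mono\<close>)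
  qed
  then show ?thesis by simp
qed

text \<open>The derivatives in the basis directions are continuous, so the sum of their norms is
  bounded on the compact set. This sum dominates the operator norm of the derivative, and convexity
  allows the mean value inequality.\<close>

lemma smooth_map_lipschitz_on:
  fixes f :: "'a::euclidean_space \<Rightarrow> 'b::real_normed_vector"
  assumes f: "smooth_map f" and S: "compact S" "convex S"
  obtains L where "L-lipschitz_on S f"
proof -
  have "Ck_map (Suc 0) f" using f by (simp add: smooth_map_def)
  then have "continuous_on S (\<lambda>x. \<Sum>i\<in>Basis. norm (frechet_derivative f (at x) i))"
    by (auto intro!: continuous_intros intro: continuous_on_subset)
  then have "compact ((\<lambda>x. \<Sum>i\<in>Basis. norm (frechet_derivative f (at x) i)) ` S)"
    using S(1) by (rule compact_continuous_image)
  then obtain L where L: "\<And>x. x \<in> S \<Longrightarrow> (\<Sum>i\<in>Basis. norm (frechet_derivative f (at x) i)) \<le> L" "0 < L"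
    using compact_imp_bounded bounded_pos[of "(\<lambda>x. \<Sum>i\<in>Basis. norm (frechet_derivative f (at x) i)) ` S"]
    by (auto simp: abs_le_iff)
  have "onorm (frechet_derivative f (at x)) \<le> L" if "x \<in> S" for x
  proof (rule onorm_le)
    fix v
    interpret D: linear "frechet_derivative f (at x)"
      using smooth_map_has_derivative[OF f] has_derivative_linear by blast
    have "norm (frechet_derivative f (at x) v) = norm (frechet_derivative f (at x) (\<Sum>i\<in>Basis. (v \<bullet> i) *\<^sub>R i))"
      by (simp add: euclidean_representation)
    also have "\<dots> \<le> (\<Sum>i\<in>Basis. norm v * norm (frechet_derivative f (at x) i))"
      unfolding D.sum D.scale
      by (rule sum_norm_le) (auto intro!: mult_right_mono Basis_le_norm)
    also have "\<dots> \<le> L * norm v"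
      using L(1)[OF that] by (simp add: sum_distrib_left[symmetric] mult.commute[of L] mult_left_mono)
    finally show "norm (frechet_derivative f (at x) v) \<le> L * norm v" .
  qed
  then have "norm (f y - f x) \<le> L * norm (y - x)" if "x \<in> S" "y \<in> S" for x y
    using differentiable_bound[OF S(2), of f "\<lambda>x. frechet_derivative f (at x)" L y x] that
      smooth_map_has_derivative[OF f] has_derivative_at_withinI by blast
  then have "L-lipschitz_on S f"
    using L(2) by (intro lipschitz_onI) (auto simp: dist_norm)
  then show ?thesis by (rule that)
qed

text \<open>This makes the description operator in \<open>flow\<close> meaningful. The substitution
  of s * t for time, with s in the unit interval, treats both signs of t at once. The two solutions
  have compact ranges, hence share a ball on which \<open>f\<close> is Lipschitz, and Gronwall's
  argument applies.\<close>

lemma ode_solution_unique: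
  fixes f :: "'a::euclidean_space \<Rightarrow> 'a"
  assumes f: "smooth_map f"
    and y: "ivp_solution f x (closed_segment 0 t) y"
    and z: "ivp_solution f x (closed_segment 0 t) z"
  shows "y t = z t"
proof -
  have seg: "(\<lambda>s. s * t) ` {0..1} \<subseteq> closed_segment 0 t"
    by (auto simp: closed_segment_def)
  have D: "((\<lambda>s. w (s * t)) has_vector_derivative t *\<^sub>R f (w (s * t))) (at s within {0..1})"
    if w: "ivp_solution f x (closed_segment 0 t) w" and s: "s \<in> {0..1}" for w s
  proof -
    have "(w has_vector_derivative f (w (s * t))) (at (s * t) within (\<lambda>s. s * t) ` {0..1})"
      using w s seg unfolding ivp_solution_def by (blast intro: has_vector_derivative_within_subset)
    moreover have "((\<lambda>s. s * t) has_vector_derivative t) (at s within {0..1})"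
      by (auto intro!: derivative_eq_intros simp: has_real_derivative_iff_has_vector_derivative[symmetric])
    ultimately show ?thesis
      using vector_diff_chain_within[of "\<lambda>s. s * t" t s "{0..1}" w "f (w (s * t))"]
      by (simp add: o_def)
  qed
  have c: "continuous_on {0..1} (\<lambda>s. w (s * t))"
    if w: "ivp_solution f x (closed_segment 0 t) w" for w
    using D[OF w] has_vector_derivative_continuous continuous_on_eq_continuous_within by blast
  define u where "u = (\<lambda>s. y (s * t) - z (s * t))"
  have "compact ((\<lambda>s. y (s * t)) ` {0..1} \<union> (\<lambda>s. z (s * t)) ` {0..1})"
    using c[OF y] c[OF z] by (intro compact_Un compact_continuous_image) auto
  then obtain R where R: "(\<lambda>s. y (s * t)) ` {0..1} \<union> (\<lambda>s. z (s * t)) ` {0..1} \<subseteq> cball 0 R"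
    using compact_imp_bounded bounded_subset_ballD ball_subset_cball by (metis subset_trans)
  obtain L where L: "L-lipschitz_on (cball 0 R) f"
    using smooth_map_lipschitz_on[OF f compact_cball convex_cball] .
  \<comment> \<open>After the time substitution the vector field is t times \<open>f\<close>, whence
    the factor |t|.\<close>
  define K where "K = L * \<bar>t\<bar>"
  text \<open>Gronwall: with $K$ a Lipschitz constant, this weighted square distance is nonincreasing.\<close>
  define p where "p = (\<lambda>s. exp (- 2 * K * s) * (u s \<bullet> u s))"
  have "p 1 \<le> p 0"
  proof (rule DERIV_nonpos_imp_decreasing_open[of 0 1 p])
    show "continuous_on {0..1} p"
      unfolding p_def u_def by (intro continuous_intros c y z)
    fix s :: real assume s: "0 < s" "s < 1"
    define d where "d = t *\<^sub>R f (y (s * t)) - t *\<^sub>R f (z (s * t))"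
    have "(u has_vector_derivative d) (at s within {0..1})"
      unfolding u_def d_def using s by (intro has_vector_derivative_diff D y z) auto
    then have u: "(u has_vector_derivative d) (at s)"
      using s at_within_Icc_at[of 0 s 1] by simp
    have "((\<lambda>s. u s \<bullet> u s) has_derivative (\<lambda>h. u s \<bullet> (h *\<^sub>R d) + (h *\<^sub>R d) \<bullet> u s)) (at s)"
      using u by (intro has_derivative_inner) (auto simp: has_vector_derivative_def)
    then have "((\<lambda>s. u s \<bullet> u s) has_real_derivative 2 * (u s \<bullet> d)) (at s)"
      by (rule has_derivative_imp_has_field_derivative) (simp add: inner_commute[of d])
    moreover have "((\<lambda>s. exp (- 2 * K * s)) has_real_derivative exp (- 2 * K * s) * (- 2 * K)) (at s)"
      by (auto intro!: derivative_eq_intros)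
    ultimately have "(p has_real_derivative
        exp (- 2 * K * s) * (- 2 * K) * (u s \<bullet> u s) + 2 * (u s \<bullet> d) * exp (- 2 * K * s)) (at s)"
      unfolding p_def by (intro DERIV_mult)
    moreover have "exp (- 2 * K * s) * (- 2 * K) * (u s \<bullet> u s) + 2 * (u s \<bullet> d) * exp (- 2 * K * s)
        = 2 * exp (- 2 * K * s) * (u s \<bullet> d - K * (u s \<bullet> u s))"
      by (simp add: algebra_simps)
    moreover have "u s \<bullet> d \<le> K * (u s \<bullet> u s)"
    proof -
      have "norm (f (y (s * t)) - f (z (s * t))) \<le> L * norm (u s)"
        unfolding u_def dist_norm[symmetric]
        using s R by (intro lipschitz_onD[OF L]) (auto simp: image_subset_iff)
      then have "norm d \<le> \<bar>t\<bar> * (L * norm (u s))"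
        unfolding d_def scaleR_diff_right[symmetric] norm_scaleR by (rule mult_left_mono) simp
      moreover have "u s \<bullet> d \<le> norm (u s) * norm d"
        by (rule norm_cauchy_schwarz)
      ultimately have "u s \<bullet> d \<le> norm (u s) * (\<bar>t\<bar> * (L * norm (u s)))"
        by (meson order_trans mult_left_mono norm_ge_zero)
      then show ?thesis
        by (simp add: K_def power2_norm_eq_inner[symmetric] power2_eq_square mult_ac)
    qed
    ultimately show "\<exists>q. (p has_real_derivative q) (at s) \<and> q \<le> 0"
      by (metis diff_le_0_iff_le exp_ge_zero mult_nonneg_nonpos mult_nonneg_nonneg zero_le_numeral)
  qed simp
  moreover have "p 0 = 0"
    using y z by (simp add: p_def u_def ivp_solution_def)
  ultimately have "u 1 \<bullet> u 1 \<le> 0"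
    by (simp add: p_def mult_le_0_iff)
  then have "u 1 = 0" by (metis antisym inner_ge_zero inner_eq_zero_iff)
  then show ?thesis by (simp add: u_def)
qed

text \<open>The interval is two-sided because h tends to 0 through both signs.\<close>

lemma picard_lindeloef:
  fixes f :: "'a::euclidean_space \<Rightarrow> 'a"
  assumes f: "smooth_map f"
  obtains y \<delta> where "0 < \<delta>" "ivp_solution f x {-\<delta>..\<delta>} y"
proof -
  obtain L where L: "L-lipschitz_on (cball x 1) f"
    using smooth_map_lipschitz_on[OF f compact_cball convex_cball] .
  text \<open>Composing $f$ with the projection $P$ onto the ball makes it globally Lipschitz and bounded,
    so Picard iteration contracts the whole space of bounded continuous functions; for small
    $\delta$ the fixed point never leaves the ball, where $P$ is the identity.\<close>
  define P where "P = closest_point (cball x 1)"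
  have P: "P z \<in> cball x 1" "dist (P z) (P z') \<le> dist z z'" for z z'
    unfolding P_def by (auto intro!: closest_point_in_set closest_point_lipschitz simp del: mem_cball)
  have P_id: "P z = z" if "z \<in> cball x 1" for z
    using that closest_point_self P_def by metis
  define g where "g = f \<circ> P"
  have L0: "0 \<le> L" using L lipschitz_on_nonneg by blast
  have gL: "dist (g z) (g z') \<le> L * dist z z'" for z z'
    using lipschitz_onD[OF L P(1) P(1)] mult_left_mono[OF P(2) L0] unfolding g_def o_def
    by (meson order_trans)
  have cg: "continuous_on UNIV g"
    using L0 gL by (intro lipschitz_on_continuous_on[of L]) (auto intro: lipschitz_onI)
  \<comment> \<open>The Lipschitz bound over a ball of radius 1 adds at most L to the norm at the
    centre.\<close>
  define B where "B = norm (f x) + L"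
  have B0: "0 \<le> B" using L0 by (simp add: B_def)
  have gB: "norm (g z) \<le> B" for z
  proof -
    have "dist (f (P z)) (f x) \<le> L * dist (P z) x"
      using P(1) by (intro lipschitz_onD[OF L]) auto
    also have "\<dots> \<le> L * 1" using P(1)[of z] L0 by (intro mult_left_mono) (auto simp: dist_commute)
    finally show ?thesis
      unfolding g_def B_def o_def using norm_triangle_ineq2[of "f (P z)" "f x"] by (simp add: dist_norm)
  qed
  \<comment> \<open>B * \<open>\<delta>\<close> <= 1 keeps the fixed point in the unit ball around
    x, and L * \<open>\<delta>\<close> <= 1/2 gives the contraction factor. The summand 1 keeps the
    denominator positive.\<close>
  define \<delta> where "\<delta> = 1 / (2 * (B + L + 1))"
  have \<delta>: "0 < \<delta>" "B * \<delta> \<le> 1" "L * \<delta> \<le> 1 / 2"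
    using L0 B0 by (auto simp: \<delta>_def field_simps)
  \<comment> \<open>The oriented integral from 0 to s; the difference gives the correct sign for
    negative s as well.\<close>
  define A where "A = (\<lambda>(h :: real \<Rightarrow> 'a) s. integral {-\<delta>..s} h - integral {-\<delta>..0} h)"
  have A': "(A h has_vector_derivative h s) (at s within {-\<delta>..\<delta>})"
    if "continuous_on {-\<delta>..\<delta>} h" "s \<in> {-\<delta>..\<delta>}" for h s
    unfolding A_def
    using has_vector_derivative_diff[OF integral_has_vector_derivative[OF that] has_vector_derivative_const]
    by simp
  have A_bound: "norm (A h s) \<le> C * \<delta>"
    if h: "continuous_on {-\<delta>..\<delta>} h" and s: "s \<in> {-\<delta>..\<delta>}" and C: "\<And>t. norm (h t) \<le> C" for h s C
  proof -
    have "norm (A h s - A h 0) \<le> C * \<bar>s - 0\<bar>"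
      by (rule has_vector_derivative_norm_bound[of "{-\<delta>..\<delta>}" _ h]) (use \<delta>(1) s in \<open>auto intro: A' h C\<close>)
    also have "\<dots> \<le> C * \<delta>"
      using s order_trans[OF norm_ge_zero C] by (intro mult_left_mono) auto
    finally show ?thesis by (simp add: A_def)
  qed
  \<comment> \<open>Bounded continuous functions live on the whole line, so the Picard operator
    \<open>T\<close> below clamps time to the interval, where \<open>c\<close> is the
    identity.\<close>
  define c where "c = (\<lambda>t. max (-\<delta>) (min \<delta> t))"
  have c: "c t \<in> {-\<delta>..\<delta>}" for t using \<delta>(1) by (auto simp: c_def)
  have cgy: "continuous_on S (\<lambda>s. g (apply_bcontfun y s))" for S and y :: "real \<Rightarrow>\<^sub>C 'a"
    by (rule continuous_on_compose2[OF cg]) auto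
  define T where "T = (\<lambda>y :: real \<Rightarrow>\<^sub>C 'a. Bcontfun (\<lambda>t. x + A (\<lambda>s. g (apply_bcontfun y s)) (c t)))"
  have T: "apply_bcontfun (T y) t = x + A (\<lambda>s. g (apply_bcontfun y s)) (c t)" for y t
  proof -
    have "(\<lambda>t. x + A (\<lambda>s. g (apply_bcontfun y s)) (c t)) \<in> bcontfun"
    proof (rule bcontfun_normI)
      have "continuous_on {-\<delta>..\<delta>} (A (\<lambda>s. g (apply_bcontfun y s)))"
        using A'[OF cgy] has_vector_derivative_continuous continuous_on_eq_continuous_within by blast
      then show "continuous_on UNIV (\<lambda>t. x + A (\<lambda>s. g (apply_bcontfun y s)) (c t))"
        by (intro continuous_on_add continuous_on_const, elim continuous_on_compose2)
          (use c in \<open>auto simp: c_def intro!: continuous_intros\<close>)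
      show "norm (x + A (\<lambda>s. g (apply_bcontfun y s)) (c t)) \<le> norm x + B * \<delta>" for t
        using norm_triangle_le A_bound[OF cgy c gB] by (metis add_left_mono)
    qed
    then show ?thesis by (simp add: T_def Bcontfun_inverse)
  qed
  have "dist (T y) (T z) \<le> 1 / 2 * dist y z" for y z
  proof (rule dist_bound)
    fix t
    have "dist (apply_bcontfun (T y) t) (apply_bcontfun (T z) t)
        = norm (A (\<lambda>s. g (apply_bcontfun y s) - g (apply_bcontfun z s)) (c t))"
    proof -
      have "(\<lambda>s. g (apply_bcontfun w s)) integrable_on {-\<delta>..r}" for r w
        by (rule integrable_continuous_real[OF cgy])
      then show ?thesis by (simp add: T A_def dist_norm integral_diff algebra_simps)
    qed
    also have "\<dots> \<le> (L * dist y z) * \<delta>"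
    proof (rule A_bound[OF _ c])
      show "continuous_on {-\<delta>..\<delta>} (\<lambda>s. g (apply_bcontfun y s) - g (apply_bcontfun z s))"
        by (intro continuous_on_diff cgy)
      show "norm (g (apply_bcontfun y t) - g (apply_bcontfun z t)) \<le> L * dist y z" for t
        using order_trans[OF gL mult_left_mono[OF dist_bounded L0]] by (simp add: dist_norm)
    qed
    also have "\<dots> \<le> 1 / 2 * dist y z"
      using mult_right_mono[OF \<delta>(3) zero_le_dist[of y z]] by (simp add: mult_ac)
    finally show "dist (apply_bcontfun (T y) t) (apply_bcontfun (T z) t) \<le> 1 / 2 * dist y z" .
  qed
  then have "\<exists>!y. T y = y"
    by (intro banach_fix_type[of "1/2"]) auto
  then obtain y where y: "T y = y" by blast
  have eq: "apply_bcontfun y t = x + A (\<lambda>s. g (apply_bcontfun y s)) t" if "t \<in> {-\<delta>..\<delta>}" for t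
    using T[of y t] y that by (simp add: c_def)
  have gf: "g (apply_bcontfun y t) = f (apply_bcontfun y t)" if "t \<in> {-\<delta>..\<delta>}" for t
  proof -
    have "norm (A (\<lambda>s. g (apply_bcontfun y s)) t) \<le> 1"
      using order_trans[OF A_bound[OF cgy that gB] \<delta>(2)] .
    then have "apply_bcontfun y t \<in> cball x 1"
      using eq[OF that] by (simp add: dist_norm)
    then show ?thesis by (simp add: g_def P_id)
  qed
  have "ivp_solution f x {-\<delta>..\<delta>} (apply_bcontfun y)"
    unfolding ivp_solution_def
  proof (intro conjI ballI)
    show "apply_bcontfun y 0 = x" using eq[of 0] \<delta>(1) by (simp add: A_def)
    fix t assume t: "t \<in> {-\<delta>..\<delta>}"
    have "((\<lambda>t. x + A (\<lambda>s. g (apply_bcontfun y s)) t) has_vector_derivative f (apply_bcontfun y t)) (at t within {-\<delta>..\<delta>})"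
      using has_vector_derivative_add[OF has_vector_derivative_const A'[OF cgy[of _ y] t], of x] gf[OF t] by simp
    then show "(apply_bcontfun y has_vector_derivative f (apply_bcontfun y t)) (at t within {-\<delta>..\<delta>})"
      by (rule has_vector_derivative_transform[OF t, rotated]) (rule eq)
  qed
  with \<delta>(1) show ?thesis by (rule that)
qed

text \<open>One local solution around 0 computes \<open>flow\<close> for all small times: its
  restriction to the segment is a witness, and uniqueness settles the description operator.\<close>

lemma flow_eq_solution:
  fixes f :: "'a::euclidean_space \<Rightarrow> 'a"
  assumes f: "smooth_map f" and y: "ivp_solution f x {-\<delta>..\<delta>} y" and t: "\<bar>t\<bar> \<le> \<delta>"
  shows "flow f t x = y t"
proof -
  have "closed_segment 0 t \<subseteq> {-\<delta>..\<delta>}"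
    using t by (auto simp: closed_segment_eq_real_ivl split: if_splits)
  then have "ivp_solution f x (closed_segment 0 t) y"
    using y unfolding ivp_solution_def by (blast intro: has_vector_derivative_within_subset)
  then show ?thesis
    unfolding flow_def using ode_solution_unique[OF f] by (blast intro!: the_equality)
qed

subsection \<open>Taylor expansion along the flow\<close>

lemma solution_has_vector_derivative:
  fixes f :: "'a::euclidean_space \<Rightarrow> 'a"
  assumes "smooth_map g" "ivp_solution f x S y" "t \<in> S"
  shows "((\<lambda>t. g (y t)) has_vector_derivative lie_derivative f g (y t)) (at t within S)"
proof -
  have "(g has_derivative frechet_derivative g (at (y t))) (at (y t) within y ` S)"
    using smooth_map_has_derivative[OF assms(1)] by (rule has_derivative_at_withinI)
  moreover have "(y has_vector_derivative f (y t)) (at t within S)"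
    using assms by (simp add: ivp_solution_def)
  ultimately show ?thesis
    unfolding lie_derivative_def using vector_derivative_diff_chain_within[of y "f (y t)" t S g]
    by (simp add: o_def)
qed

text \<open>Induction on n for all g at once: the derivative of the remainder of order n + 1 for g
  is the remainder of order n for the Lie derivative of g, and integrating its bound from 0 to t
  gains one power of |t|.\<close>

lemma taylor_along_solution:
  fixes f g :: "'a::euclidean_space \<Rightarrow> 'a"
  assumes "smooth_map f" and y: "ivp_solution f x {-\<delta>..\<delta>} y" and "0 < \<delta>" and "smooth_map g"
  shows "\<exists>C. \<forall>t. \<bar>t\<bar> \<le> \<delta> \<longrightarrow>
    norm (g (y t) - (\<Sum>j<n. (t ^ j / fact j) *\<^sub>R (lie_derivative f ^^ j) g x)) \<le> C * \<bar>t\<bar> ^ n"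
  using assms(4)
proof (induction n arbitrary: g)
  case 0
  have "continuous_on {-\<delta>..\<delta>} (\<lambda>t. g (y t))"
    using solution_has_vector_derivative[OF 0 y] has_vector_derivative_continuous
      continuous_on_eq_continuous_within by blast
  then have "bounded ((\<lambda>t. g (y t)) ` {-\<delta>..\<delta>})"
    by (intro compact_imp_bounded compact_continuous_image) auto
  then obtain C where "\<forall>t\<in>{-\<delta>..\<delta>}. norm (g (y t)) \<le> C"
    unfolding bounded_iff by blast
  then show ?case by (auto simp: abs_le_iff intro!: exI[of _ C])
next
  case (Suc n)
  let ?D = "lie_derivative f g"
  obtain C where C: "\<And>t. \<bar>t\<bar> \<le> \<delta> \<Longrightarrow>
      norm (?D (y t) - (\<Sum>j<n. (t ^ j / fact j) *\<^sub>R (lie_derivative f ^^ j) ?D x)) \<le> C * \<bar>t\<bar> ^ n"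
    using Suc.IH[OF smooth_map_lie_derivative[OF assms(1) Suc.prems]] by blast
  define w where "w = (\<lambda>t. g (y t) - (\<Sum>j<Suc n. (t ^ j / fact j) *\<^sub>R (lie_derivative f ^^ j) g x))"
  have w: "(w has_vector_derivative
      ?D (y t) - (\<Sum>j<n. (t ^ j / fact j) *\<^sub>R (lie_derivative f ^^ j) ?D x)) (at t within S)"
    if "t \<in> S" "S \<subseteq> {-\<delta>..\<delta>}" for t S
  proof -
    have "((\<lambda>t. (t ^ Suc j / fact (Suc j)) *\<^sub>R a) has_vector_derivative (t ^ j / fact j) *\<^sub>R a) (at t within S)"
      for j and a :: 'a
    proof -
      have "((\<lambda>t. t ^ Suc j / fact (Suc j)) has_real_derivative t ^ j / fact j) (at t within S)"
        using DERIV_cdivide[OF DERIV_pow[of "Suc j" t S], of "fact (Suc j)"]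
        by (simp del: power_Suc of_nat_Suc)
      then have "((\<lambda>t. t ^ Suc j / fact (Suc j)) has_vector_derivative t ^ j / fact j) (at t within S)"
        by (simp only: has_real_derivative_iff_has_vector_derivative)
      then show ?thesis
        using bounded_linear.has_vector_derivative[OF bounded_linear_scaleR_left] by blast
    qed
    moreover have "((\<lambda>t. g (y t)) has_vector_derivative ?D (y t)) (at t within S)"
      using solution_has_vector_derivative[OF Suc.prems y] that
        has_vector_derivative_within_subset by blast
    ultimately have "((\<lambda>t. g (y t) - (g x + (\<Sum>j<n. (t ^ Suc j / fact (Suc j)) *\<^sub>R (lie_derivative f ^^ j) ?D x)))
        has_vector_derivative ?D (y t) - (0 + (\<Sum>j<n. (t ^ j / fact j) *\<^sub>R (lie_derivative f ^^ j) ?D x)))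
        (at t within S)"
      by (intro has_vector_derivative_diff has_vector_derivative_add has_vector_derivative_const
          has_vector_derivative_sum) auto
    \<comment> \<open>The term j = 0 is the constant \<open>g x\<close>; shifting the remaining
      indices by one matches the iterates applied to \<open>?D\<close> with the higher iterates
      applied to \<open>g\<close>.\<close>
    then show ?thesis
      by (simp add: w_def sum.lessThan_Suc_shift funpow_swap1 del: sum.lessThan_Suc power_Suc fact_Suc)
  qed
  have "norm (w t) \<le> \<bar>C\<bar> * \<bar>t\<bar> ^ Suc n" if t: "\<bar>t\<bar> \<le> \<delta>" for t
  proof -
    \<comment> \<open>Working on this segment instead of the whole interval bounds the derivative by
      a power of |t|; the length of the segment supplies the extra factor.\<close>
    have seg: "\<bar>s\<bar> \<le> \<bar>t\<bar>" if "s \<in> closed_segment 0 t" for s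
      using that by (auto simp: closed_segment_eq_real_ivl split: if_splits)
    have "norm (w t - w 0) \<le> (\<bar>C\<bar> * \<bar>t\<bar> ^ n) * \<bar>t - 0\<bar>"
    proof (rule has_vector_derivative_norm_bound[OF convex_closed_segment w])
      show "closed_segment 0 t \<subseteq> {-\<delta>..\<delta>}" using seg t by fastforce
      fix s assume s: "s \<in> closed_segment 0 t"
      have "C * \<bar>s\<bar> ^ n \<le> \<bar>C\<bar> * \<bar>t\<bar> ^ n"
        using seg[OF s] by (intro mult_mono power_mono) auto
      then show "norm (?D (y s) - (\<Sum>j<n. (s ^ j / fact j) *\<^sub>R (lie_derivative f ^^ j) ?D x))
          \<le> \<bar>C\<bar> * \<bar>t\<bar> ^ n"
        using C[of s] seg[OF s] t by linarith
    qed auto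
    moreover have "w 0 = 0"
      using y by (simp add: w_def ivp_solution_def sum.lessThan_Suc_shift del: sum.lessThan_Suc)
    ultimately show ?thesis by (simp add: mult_ac)
  qed
  then show ?case unfolding w_def by blast
qed

text \<open>For fixed c the time c * h eventually enters the interval of a local solution at x,
  where the previous estimate holds. Later c is the step number m.\<close>

lemma flow_taylor:
  fixes f g :: "'a::euclidean_space \<Rightarrow> 'a"
  assumes f: "smooth_map f" and g: "smooth_map g"
  shows "(\<lambda>h. norm (g (flow f (c * h) x)
           - (\<Sum>j<n. (c ^ j * h ^ j / fact j) *\<^sub>R (lie_derivative f ^^ j) g x))) \<in> O[at 0](\<lambda>h. h ^ n)"
proof -
  obtain y \<delta> where \<delta>: "0 < \<delta>" and y: "ivp_solution f x {-\<delta>..\<delta>} y"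
    using picard_lindeloef[OF f] .
  obtain C where C: "\<And>t. \<bar>t\<bar> \<le> \<delta> \<Longrightarrow>
      norm (g (y t) - (\<Sum>j<n. (t ^ j / fact j) *\<^sub>R (lie_derivative f ^^ j) g x)) \<le> C * \<bar>t\<bar> ^ n"
    using taylor_along_solution[OF f y \<delta> g] by blast
  have "((\<lambda>h. \<bar>c * h\<bar>) \<longlongrightarrow> \<bar>c * 0\<bar>) (at 0)"
    by (intro tendsto_intros)
  then have "\<forall>\<^sub>F h in at 0. \<bar>c * h\<bar> < \<delta>"
    using \<delta> by (intro order_tendstoD) auto
  then have "\<forall>\<^sub>F h in at 0. norm (norm (g (flow f (c * h) x)
      - (\<Sum>j<n. (c ^ j * h ^ j / fact j) *\<^sub>R (lie_derivative f ^^ j) g x))) \<le> (C * \<bar>c\<bar> ^ n) * norm (h ^ n)"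
  proof eventually_elim
    case (elim h)
    then show ?case
      using C[of "c * h"] flow_eq_solution[OF f y, of "c * h"]
      by (simp add: power_mult_distrib abs_mult power_abs)
  qed
  then show ?thesis by (rule bigoI)
qed

text \<open>The first-order case of the expansion of the identity. The uniqueness proof needs it to
  pass to the limit inside merely continuous functions.\<close>

lemma flow_tendsto_start:
  fixes f :: "'a::euclidean_space \<Rightarrow> 'a"
  assumes "smooth_map f"
  shows "((\<lambda>h. flow f (c * h) x) \<longlongrightarrow> x) (at 0)"
proof -
  have "(\<lambda>h. norm (flow f (c * h) x - x)) \<in> O[at 0](\<lambda>h. h)"
    using flow_taylor[OF assms smooth_map_id, of c x 1] by simp
  moreover have "(\<lambda>h. h) \<in> o[at 0](\<lambda>h. 1 :: real)"
    by (rule smalloI_tendsto) (auto intro!: tendsto_eq_intros)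
  ultimately have "(\<lambda>h. norm (flow f (c * h) x - x)) \<in> o[at 0](\<lambda>h. 1)"
    by (rule landau_o.big_small_trans)
  then have "((\<lambda>h. norm (flow f (c * h) x - x)) \<longlongrightarrow> 0) (at 0)"
    by (auto dest: smalloD_tendsto)
  then have "((\<lambda>h. flow f (c * h) x - x) \<longlongrightarrow> 0) (at 0)"
    by (rule tendsto_norm_zero_cancel)
  then show ?thesis by (rule LIM_zero_cancel)
qed

section \<open>Big-O arithmetic for norms of vector-valued functions\<close>

lemma bigo_norm_add:
  fixes u v :: "'b \<Rightarrow> 'a::real_normed_vector"
  assumes "(\<lambda>h. norm (u h)) \<in> O[F](r)" "(\<lambda>h. norm (v h)) \<in> O[F](r)"
  shows "(\<lambda>h. norm (u h + v h)) \<in> O[F](r)"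
proof -
  have "(\<lambda>h. norm (u h + v h)) \<in> O[F](\<lambda>h. norm (u h) + norm (v h))"
    by (rule bigoI[of _ 1]) (simp add: norm_triangle_ineq)
  then show ?thesis
    using sum_in_bigo(1)[OF assms] landau_o.big_trans by blast
qed

lemma bigo_norm_scaleR:
  fixes u :: "real \<Rightarrow> 'a::real_normed_vector"
  assumes "(\<lambda>h. norm (u h)) \<in> O[F](r)" "c \<in> O[F](s)"
  shows "(\<lambda>h. norm (c h *\<^sub>R u h)) \<in> O[F](\<lambda>h. s h * r h)"
  using landau_o.big_mult[OF assms(2,1)] landau_o.big.norm_iff[of "\<lambda>h. c h * norm (u h)"]
  by (simp add: abs_mult)

lemma bigo_norm_sum:
  fixes u :: "'i \<Rightarrow> 'b \<Rightarrow> 'a::real_normed_vector"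
  assumes "\<And>i. i \<in> A \<Longrightarrow> (\<lambda>h. norm (u i h)) \<in> O[F](r)"
  shows "(\<lambda>h. norm (\<Sum>i\<in>A. u i h)) \<in> O[F](r)"
  using assms by (induction A rule: infinite_finite_induct) (auto intro: bigo_norm_add)

lemma bigo_norm_diff:
  fixes u v :: "'b \<Rightarrow> 'a::real_normed_vector"
  assumes "(\<lambda>h. norm (u h)) \<in> O[F](r)" "(\<lambda>h. norm (v h)) \<in> O[F](r)"
  shows "(\<lambda>h. norm (u h - v h)) \<in> O[F](r)"
  using bigo_norm_add[of u F r "\<lambda>h. - v h"] assms by simp

subsection \<open>Inverse modified equation\<close>

text \<open>The point y is abstracted on the right because \<open>lie_derivative\<close> acts on the
  earlier fields as functions. Since j starts at 1, only smaller indices are called.\<close>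

fun lmm_field ::
  "nat \<Rightarrow> (nat \<Rightarrow> real) \<Rightarrow> (nat \<Rightarrow> real) \<Rightarrow> ('a::real_normed_vector \<Rightarrow> 'a) \<Rightarrow> nat \<Rightarrow> 'a \<Rightarrow> 'a" where
  "lmm_field M \<alpha> \<beta> f k = (\<lambda>y.
     (\<Sum>m\<le>M. (\<alpha> m * (real m ^ (k + 1) / fact (k + 1))) *\<^sub>R (lie_derivative f ^^ k) f y)
     - (\<Sum>m\<le>M. \<beta> m *\<^sub>R
          (\<Sum>j=1..k. (real m ^ j / fact j) *\<^sub>R (lie_derivative f ^^ j) (lmm_field M \<alpha> \<beta> f (k - j)) y)))"

declare lmm_field.simps [simp del]

lemma smooth_map_lmm_field:
  fixes f :: "'a::euclidean_space \<Rightarrow> 'a"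
  assumes "smooth_map f"
  shows "smooth_map (lmm_field M \<alpha> \<beta> f k)"
proof (induction k rule: less_induct)
  case (less k)
  then show ?case
    by (subst lmm_field.simps)
      (intro smooth_map_diff smooth_map_sum smooth_map_scaleR_const
        smooth_map_lie_derivative_funpow assms, auto)
qed

text \<open>Here n = k + j is the total power of h: on the left the terms are grouped by field, on
  the right by power.\<close>

lemma sum_triangle_reindex:
  fixes a :: "nat \<Rightarrow> nat \<Rightarrow> 'a::comm_monoid_add"
  shows "(\<Sum>k\<le>K. \<Sum>j<Suc K - k. a k j) = (\<Sum>n\<le>K. \<Sum>j\<le>n. a (n - j) j)"
  unfolding sum.Sigma[OF finite_atMost ballI[OF finite_lessThan]]
    sum.Sigma[OF finite_atMost ballI[OF finite_atMost]]
  by (rule sum.reindex_bij_witness[of _ "\<lambda>(n, j). (n - j, j)" "\<lambda>(k, j). (k + j, j)"]) auto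

text \<open>This is the comparison of the coefficients of h^(n+1). Isolating j = 0 leaves the field
  of index n with factor 1, and the rest is the recursion.\<close>

lemma lmm_field_order_condition:
  fixes f :: "'a::real_normed_vector \<Rightarrow> 'a"
  assumes "(\<Sum>m\<le>M. \<beta> m) = 1"
  shows "(\<Sum>j\<le>n. \<Sum>m\<le>M. (\<beta> m * (real m ^ j / fact j)) *\<^sub>R (lie_derivative f ^^ j) (lmm_field M \<alpha> \<beta> f (n - j)) x)
    = (\<Sum>m\<le>M. (\<alpha> m * (real m ^ (n + 1) / fact (n + 1))) *\<^sub>R (lie_derivative f ^^ n) f x)"
proof -
  let ?c = "\<lambda>j m. (\<beta> m * (real m ^ j / fact j)) *\<^sub>R (lie_derivative f ^^ j) (lmm_field M \<alpha> \<beta> f (n - j)) x"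
  have "(\<Sum>j\<le>n. \<Sum>m\<le>M. ?c j m) = (\<Sum>m\<le>M. ?c 0 m) + (\<Sum>j=1..n. \<Sum>m\<le>M. ?c j m)"
    by (simp add: atMost_atLeast0 sum.atLeast_Suc_atMost)
  \<comment> \<open>Since \<open>real m ^ 0 = 1\<close> also for m = 0, every
    \<open>\<beta> m\<close> contributes.\<close>
  also have "(\<Sum>m\<le>M. ?c 0 m) = lmm_field M \<alpha> \<beta> f n x"
    using assms by (simp add: scaleR_sum_left[symmetric])
  also have "(\<Sum>j=1..n. \<Sum>m\<le>M. ?c j m) = (\<Sum>m\<le>M. \<beta> m *\<^sub>R
      (\<Sum>j=1..n. (real m ^ j / fact j) *\<^sub>R (lie_derivative f ^^ j) (lmm_field M \<alpha> \<beta> f (n - j)) x))"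
    by (subst sum.swap) (simp add: scaleR_sum_right)
  finally show ?thesis by (simp add: lmm_field.simps[of M \<alpha> \<beta> f n])
qed

text \<open>Each flow value is replaced by a Taylor polynomial plus a remainder. The polynomial
  parts cancel exactly, so the defect consists of remainders only.\<close>

lemma lmm_matches_flow_lmm_field:
  fixes f :: "'a::euclidean_space \<Rightarrow> 'a"
  assumes f: "smooth_map f" and \<alpha>: "(\<Sum>m\<le>M. \<alpha> m) = 0" and \<beta>: "(\<Sum>m\<le>M. \<beta> m) = 1"
  shows "lmm_matches_flow M \<alpha> \<beta> f (lmm_field M \<alpha> \<beta> f)"
  unfolding lmm_matches_flow_def
proof (intro allI)
  fix K x
  define F where "F = lmm_field M \<alpha> \<beta> f"
  define D where "D = (\<lambda>j g. (lie_derivative f ^^ j) g x)"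
  define Y where "Y = (\<lambda>m h. flow f (real m * h) x)"
  define T where "T = (\<lambda>g n m h. \<Sum>j<n. (real m ^ j * h ^ j / fact j) *\<^sub>R D j g)"
  have T: "(\<lambda>h. norm (g (Y m h) - T g n m h)) \<in> O[at 0](\<lambda>h. h ^ n)" if "smooth_map g" for g n m
    unfolding T_def Y_def D_def by (rule flow_taylor[OF f that])
  \<comment> \<open>The field of index k already carries h^(k+1), so a remainder of order
    \<open>Suc K - k\<close> suffices to reach the total order K + 2.\<close>
  let ?R = "\<lambda>h. (\<Sum>m\<le>M. \<alpha> m *\<^sub>R (Y m h - T (\<lambda>x. x) (K + 2) m h))
      - (\<Sum>m\<le>M. \<Sum>k\<le>K. (\<beta> m * h ^ Suc k) *\<^sub>R (F k (Y m h) - T (F k) (Suc K - k) m h))"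
  have "(\<lambda>h. norm (?R h)) \<in> O[at 0](\<lambda>h. h ^ (K + 2))"
  proof (intro bigo_norm_diff bigo_norm_sum)
    fix m
    show "(\<lambda>h. norm (\<alpha> m *\<^sub>R (Y m h - T (\<lambda>x. x) (K + 2) m h))) \<in> O[at 0](\<lambda>h. h ^ (K + 2))"
      using bigo_norm_scaleR[OF T[OF smooth_map_id, of m "K + 2"], where c = "\<lambda>_. \<alpha> m" and s = "\<lambda>_. 1"]
      by (simp del: add_2_eq_Suc' power_Suc)
    fix k assume "k \<in> {..K}"
    then have "K + 2 = Suc k + (Suc K - k)" by simp
    then have "h ^ (K + 2) = h ^ Suc k * h ^ (Suc K - k)" for h :: real
      by (simp only: power_add)
    moreover have "smooth_map (F k)"
      unfolding F_def by (rule smooth_map_lmm_field[OF f])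
    ultimately show "(\<lambda>h. norm ((\<beta> m * h ^ Suc k) *\<^sub>R (F k (Y m h) - T (F k) (Suc K - k) m h)))
        \<in> O[at 0](\<lambda>h. h ^ (K + 2))"
      using bigo_norm_scaleR[OF T, of "F k", where c = "\<lambda>h. \<beta> m * h ^ Suc k" and s = "\<lambda>h. h ^ Suc k"]
      by (simp del: power_Suc)
  qed
  moreover have "(\<Sum>m\<le>M. \<alpha> m *\<^sub>R T (\<lambda>x. x) (K + 2) m h)
      = (\<Sum>m\<le>M. \<Sum>k\<le>K. (\<beta> m * h ^ Suc k) *\<^sub>R T (F k) (Suc K - k) m h)" for h
  proof -
    \<comment> \<open>The Lie derivative of the identity is \<open>f\<close>, which lowers the
      iterates by one. The constant term x drops out once weighted with the
      \<open>\<alpha> m\<close>, whose sum is 0.\<close>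
    have "T (\<lambda>x. x) (K + 2) m h = x + (\<Sum>n\<le>K. (real m ^ Suc n * h ^ Suc n / fact (Suc n)) *\<^sub>R D n f)" for m
    proof -
      have "D (Suc n) (\<lambda>x. x) = D n f" for n
        by (simp add: D_def funpow_Suc_right lie_derivative_id del: funpow.simps)
      moreover have "D 0 (\<lambda>x. x) = x" by (simp add: D_def)
      ultimately show ?thesis
        unfolding T_def add_2_eq_Suc' sum.lessThan_Suc_shift[of _ "Suc K"]
        by (simp add: lessThan_Suc_atMost del: sum.lessThan_Suc power_Suc fact_Suc)
    qed
    then have "(\<Sum>m\<le>M. \<alpha> m *\<^sub>R T (\<lambda>x. x) (K + 2) m h)
        = (\<Sum>m\<le>M. \<alpha> m *\<^sub>R x) + (\<Sum>m\<le>M. \<Sum>n\<le>K. (\<alpha> m * (real m ^ Suc n * h ^ Suc n / fact (Suc n))) *\<^sub>R D n f)"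
      by (simp add: scaleR_right_distrib sum.distrib scaleR_sum_right del: power_Suc fact_Suc)
    also have "(\<Sum>m\<le>M. \<alpha> m *\<^sub>R x) = 0"
      using \<alpha> by (simp add: scaleR_sum_left[symmetric])
    also have "(\<Sum>m\<le>M. \<Sum>n\<le>K. (\<alpha> m * (real m ^ Suc n * h ^ Suc n / fact (Suc n))) *\<^sub>R D n f)
        = (\<Sum>n\<le>K. h ^ Suc n *\<^sub>R (\<Sum>m\<le>M. (\<alpha> m * (real m ^ (n + 1) / fact (n + 1))) *\<^sub>R D n f))"
      by (subst sum.swap) (simp add: scaleR_sum_right mult_ac del: power_Suc fact_Suc)
    also have "\<dots> = (\<Sum>n\<le>K. h ^ Suc n *\<^sub>R
        (\<Sum>j\<le>n. \<Sum>m\<le>M. (\<beta> m * (real m ^ j / fact j)) *\<^sub>R D j (F (n - j))))"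
      unfolding D_def F_def lmm_field_order_condition[OF \<beta>] ..
    also have "\<dots> = (\<Sum>n\<le>K. \<Sum>j\<le>n. \<Sum>m\<le>M.
        (\<beta> m * h ^ Suc (n - j)) *\<^sub>R (real m ^ j * h ^ j / fact j) *\<^sub>R D j (F (n - j)))"
    proof -
      \<comment> \<open>The first factor belongs to the field of index n - j in the truncated
        series, the second to the Taylor term of order j.\<close>
      have "h ^ Suc n = h ^ Suc (n - j) * h ^ j" if "j \<le> n" for j n
        using that by (simp add: power_add[symmetric])
      then show ?thesis
        by (simp add: scaleR_sum_right mult_ac del: power_Suc fact_Suc)
    qed
    also have "\<dots> = (\<Sum>k\<le>K. \<Sum>j<Suc K - k. \<Sum>m\<le>M.
        (\<beta> m * h ^ Suc k) *\<^sub>R (real m ^ j * h ^ j / fact j) *\<^sub>R D j (F k))"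
      by (simp only: sum_triangle_reindex)
    also have "\<dots> = (\<Sum>k\<le>K. \<Sum>m\<le>M. (\<beta> m * h ^ Suc k) *\<^sub>R T (F k) (Suc K - k) m h)"
      unfolding T_def scaleR_sum_right by (intro sum.cong refl sum.swap)
    also have "\<dots> = (\<Sum>m\<le>M. \<Sum>k\<le>K. (\<beta> m * h ^ Suc k) *\<^sub>R T (F k) (Suc K - k) m h)"
      by (rule sum.swap)
    finally show ?thesis by simp
  qed
  then have "(\<Sum>m\<le>M. \<alpha> m *\<^sub>R Y m h) - h *\<^sub>R (\<Sum>m\<le>M. \<beta> m *\<^sub>R truncated_field F K h (Y m h)) = ?R h" for h
    unfolding scaleR_diff_right sum_subtractf
    by (simp add: truncated_field_def scaleR_sum_right mult_ac)
  ultimately show "(\<lambda>h. norm ((\<Sum>m\<le>M. \<alpha> m *\<^sub>R flow f (real m * h) x)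
      - h *\<^sub>R (\<Sum>m\<le>M. \<beta> m *\<^sub>R truncated_field (lmm_field M \<alpha> \<beta> f) K h (flow f (real m * h) x))))
    \<in> O[at 0](\<lambda>h. h ^ (K + 2))"
    by (simp add: Y_def F_def)
qed

text \<open>In the induction step the condition is used at truncation index k, where the two defects
  differ by h^(k+1) times \<open>e h\<close>; comparison with h^(k+2) forces \<open>e\<close> to
  tend to 0.\<close>

lemma lmm_matches_flow_unique:
  fixes f :: "'a::euclidean_space \<Rightarrow> 'a"
  assumes f: "smooth_map f" and \<beta>: "(\<Sum>m\<le>M. \<beta> m) = 1"
    and F: "\<And>k. continuous_on UNIV (F k)" "lmm_matches_flow M \<alpha> \<beta> f F"
    and G: "\<And>k. continuous_on UNIV (G k)" "lmm_matches_flow M \<alpha> \<beta> f G"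
  shows "G k = F k"
proof (induction k rule: less_induct)
  case (less k)
  show ?case
  proof
    fix x
    define Y where "Y = (\<lambda>m h. flow f (real m * h) x)"
    define e where "e = (\<lambda>h. \<Sum>m\<le>M. \<beta> m *\<^sub>R (G k (Y m h) - F k (Y m h)))"
    let ?E = "\<lambda>H h. (\<Sum>m\<le>M. \<alpha> m *\<^sub>R Y m h) - h *\<^sub>R (\<Sum>m\<le>M. \<beta> m *\<^sub>R truncated_field H k h (Y m h))"
    have "truncated_field G k h y - truncated_field F k h y = h ^ k *\<^sub>R (G k y - F k y)" for h y
    proof -
      have "truncated_field G k h y - truncated_field F k h y = (\<Sum>i\<le>k. h ^ i *\<^sub>R (G i y - F i y))"
        by (simp add: truncated_field_def sum_subtractf scaleR_diff_right)
      also have "\<dots> = (\<Sum>i\<in>{k}. h ^ i *\<^sub>R (G i y - F i y))"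
        by (rule sum.mono_neutral_right) (use less in auto)
      finally show ?thesis by simp
    qed
    then have "?E F h - ?E G h = h ^ Suc k *\<^sub>R e h" for h
      by (simp add: e_def scaleR_sum_right sum_subtractf[symmetric] scaleR_diff_right[symmetric] mult_ac)
    moreover have "(\<lambda>h. norm (?E F h - ?E G h)) \<in> O[at 0](\<lambda>h. h ^ (k + 2))"
      using F(2) G(2) unfolding lmm_matches_flow_def Y_def by (intro bigo_norm_diff[where u = "?E F" and v = "?E G", unfolded Y_def]) blast+
    ultimately have "(\<lambda>h. norm (h ^ Suc k *\<^sub>R e h)) \<in> O[at 0](\<lambda>h. h ^ (k + 2))"
      by simp
    then obtain C where C: "\<forall>\<^sub>F h in at 0. norm (h ^ Suc k *\<^sub>R e h) \<le> C * norm (h ^ (k + 2))"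
      by (auto elim: landau_o.bigE)
    \<comment> \<open>The filter \<open>at 0\<close> excludes h = 0, so the common power of |h| can
      be cancelled.\<close>
    have "\<forall>\<^sub>F h in at 0. norm (e h) \<le> C * \<bar>h\<bar>"
      using C eventually_neq_at_within[of "0::real" 0 UNIV]
    proof eventually_elim
      case (elim h)
      then have "\<bar>h\<bar> ^ Suc k * norm (e h) \<le> \<bar>h\<bar> ^ Suc k * (C * \<bar>h\<bar>)"
        by (simp add: power_abs abs_mult mult_ac)
      then show ?case
        using elim by (subst (asm) mult_le_cancel_left_pos) auto
    qed
    moreover have "((\<lambda>h. C * \<bar>h\<bar>) \<longlongrightarrow> 0) (at 0)"
      by (auto intro!: tendsto_eq_intros)
    ultimately have "(e \<longlongrightarrow> 0) (at 0)"
      by (rule Lim_null_comparison)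
    moreover have "(e \<longlongrightarrow> (\<Sum>m\<le>M. \<beta> m *\<^sub>R (G k x - F k x))) (at 0)"
      unfolding e_def Y_def
      by (intro tendsto_intros isCont_tendsto_compose[OF _ flow_tendsto_start[OF f]])
        (use F(1) G(1) in \<open>auto simp: continuous_on_eq_continuous_at\<close>)
    ultimately have "(\<Sum>m\<le>M. \<beta> m *\<^sub>R (G k x - F k x)) = 0"
      by (intro tendsto_unique[of "at (0::real)"]) auto
    \<comment> \<open>The difference at x does not depend on m, and the weights
      \<open>\<beta> m\<close> sum to 1.\<close>
    then show "G k x = F k x"
      using \<beta> by (simp add: scaleR_sum_left[symmetric])
  qed
qed

text \<open>Uniqueness is asserted among all continuous families, a larger class than that of the
  smooth ones to which the witness \<open>lmm_field\<close> belongs.\<close>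

theorem theorem3:
  fixes f :: "real ^ 'd \<Rightarrow> real ^ 'd"
    and M :: nat
    and \<alpha> \<beta> :: "nat \<Rightarrow> real"
  assumes "smooth_map f"
    and "linear_multistep_method M \<alpha> \<beta>"
    and "weakly_stable M \<alpha>"
    and "consistent M \<alpha> \<beta>"
    and "(\<Sum>m\<le>M. \<beta> m) = 1"
  shows "\<exists>F :: nat \<Rightarrow> real ^ 'd \<Rightarrow> real ^ 'd.
    (\<forall>k. smooth_map (F k)) \<and>
    lmm_matches_flow M \<alpha> \<beta> f F \<and>
    (\<forall>G. (\<forall>k. continuous_on UNIV (G k)) \<and> lmm_matches_flow M \<alpha> \<beta> f G \<longrightarrow> G = F) \<and>
    (\<forall>k y. F k y =
       (\<Sum>m\<le>M. (\<alpha> m * (real m ^ (k + 1) / fact (k + 1))) *\<^sub>R (lie_derivative f ^^ k) f y)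
       - (\<Sum>m\<le>M. \<beta> m *\<^sub>R
            (\<Sum>j=1..k. (real m ^ j / fact j) *\<^sub>R (lie_derivative f ^^ j) (F (k - j)) y)))"
proof (intro exI[of _ "lmm_field M \<alpha> \<beta> f"] conjI allI impI)
  show smooth: "smooth_map (lmm_field M \<alpha> \<beta> f k)" for k
    by (rule smooth_map_lmm_field[OF assms(1)])
  show matches: "lmm_matches_flow M \<alpha> \<beta> f (lmm_field M \<alpha> \<beta> f)"
    using assms(1,4,5) by (intro lmm_matches_flow_lmm_field) (auto simp: consistent_def)
  show "G = lmm_field M \<alpha> \<beta> f"
    if "(\<forall>k. continuous_on UNIV (G k)) \<and> lmm_matches_flow M \<alpha> \<beta> f G" for G
    using that lmm_matches_flow_unique[OF assms(1,5) smooth_map_imp_continuous_on[OF smooth] matches]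
    by blast
qed (subst lmm_field.simps, rule refl)

end
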